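(* The set $D$ of all real valued sequences uniformly distributed in $[-1/2,1/2]$, i.e. the set of all $(x_k)_{k\in\mathbb{N}}\in\mathbb{R}^{\mathbb{N}}$ such that for all $c,d$ with $-\tfrac12\le c<d\le \tfrac12$ $$\lim_{n\to\infty}\frac{\#\{k : 1\le k\le n,\ x_k\in[c,d]\}}{n}=d-c,$$ is shy in $\mathbb{R}^{\mathbb{N}}$.
   Context: $\mathbb{N}=\{1,2,3,\dots\}$, and $\mathbb{R}^{\mathbb{N}}$ (also written $\mathbf{R}^{\infty}$) is the space of all real sequences with the product topology, regarded as a complete metric linear space. Shyness. Let $V$ be a complete metric linear space (a vector space with a complete metric for which addition and scalar multiplication are continuous). A measure on $V$ means a nonnegative measure defined on the Borel sets of $V$ and not identically zero. A measure $\mu$ on $V$ is transverse to a Borel set $S\subset V$ if (i) there is a compact set $U\subset V$ with $0<\mu(U)<1$, and (ii) $\mu(S+v)=0$ for every $v\in V$. A Borel set $S\subset V$ is shy if there exists a measure transverse to $S$. A general subset of $V$ is shy if it is contained in a Borel shy set. *)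

theory Defs
  imports "HOL-Analysis.Analysis" "HOL-Library.Function_Algebras"
begin

class complete_metric_linear_space = real_vector + complete_space + topological_monoid_add +
  assumes tendsto_scaleR_Pair: "LIM p (nhds a \<times>\<^sub>F nhds x). fst p *\<^sub>R snd p :> nhds (a *\<^sub>R x)"

instance real :: complete_metric_linear_space
proof
  fix a x :: real
  show "LIM p (nhds a \<times>\<^sub>F nhds x). fst p *\<^sub>R snd p :> nhds (a *\<^sub>R x)"
    by (intro tendsto_scaleR filterlim_fst filterlim_snd)
qed

text \<open>
  Pointwise scalar multiplication on function spaces. Addition comes from
  HOL-Library.Function_Algebras; the product topology and, for countable index types, a complete
  metric inducing it come from HOL-Analysis.
\<close>

instantiation "fun" :: (type, real_vector) real_vector
begin

definition scaleR_fun :: "real \<Rightarrow> ('a \<Rightarrow> 'b) \<Rightarrow> 'a \<Rightarrow> 'b"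
  where "scaleR_fun r f = (\<lambda>i. r *\<^sub>R f i)"

instance
  by standard (simp_all add: scaleR_fun_def fun_eq_iff scaleR_add_right scaleR_add_left)

end

lemma tendsto_fun_iff:
  fixes l :: "'i \<Rightarrow> 'b::topological_space"
  shows "(f \<longlongrightarrow> l) F \<longleftrightarrow> (\<forall>i. ((\<lambda>x. f x i) \<longlongrightarrow> l i) F)"
proof -
  have "limitin (product_topology (\<lambda>_. euclidean) UNIV) f l F
      \<longleftrightarrow> (\<forall>i. limitin euclidean (\<lambda>x. f x i) (l i) F)"
    by (simp add: limitin_componentwise)
  then show ?thesis
    by (simp add: euclidean_product_topology)
qed

lemma tendsto_nhds_component:
  fixes l :: "'i \<Rightarrow> 'b::topological_space"
  shows "((\<lambda>f. f i) \<longlongrightarrow> l i) (nhds l)"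
  using tendsto_fun_iff[of "\<lambda>f. f" l "nhds l"] by (simp add: filterlim_ident)

instance "fun" :: (type, topological_monoid_add) topological_monoid_add
proof
  fix a b :: "'a \<Rightarrow> 'b"
  have "((\<lambda>p. fst p i + snd p i) \<longlongrightarrow> a i + b i) (nhds a \<times>\<^sub>F nhds b)" for i
    by (intro tendsto_add filterlim_compose[OF tendsto_nhds_component filterlim_fst]
        filterlim_compose[OF tendsto_nhds_component filterlim_snd])
  then show "LIM p (nhds a \<times>\<^sub>F nhds b). fst p + snd p :> nhds (a + b)"
    by (simp add: tendsto_fun_iff)
qed

instance "fun" :: (countable, complete_metric_linear_space) complete_metric_linear_space
proof
  fix a :: real and x :: "'a \<Rightarrow> 'b"
  have "((\<lambda>p. fst p *\<^sub>R snd p i) \<longlongrightarrow> a *\<^sub>R x i) (nhds a \<times>\<^sub>F nhds x)" for i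
  proof -
    have "LIM p (nhds a \<times>\<^sub>F nhds x). (fst p, snd p i) :> nhds a \<times>\<^sub>F nhds (x i)"
      by (intro filterlim_Pair filterlim_fst
          filterlim_compose[OF tendsto_nhds_component filterlim_snd])
    from filterlim_compose[OF tendsto_scaleR_Pair this] show ?thesis
      by simp
  qed
  then show "LIM p (nhds a \<times>\<^sub>F nhds x). fst p *\<^sub>R snd p :> nhds (a *\<^sub>R x)"
    by (simp add: tendsto_fun_iff scaleR_fun_def)
qed

definition nonzero_borel_measure :: "'a::topological_space measure \<Rightarrow> bool"
  where "nonzero_borel_measure \<mu> \<longleftrightarrow> sets \<mu> = sets borel \<and> emeasure \<mu> UNIV \<noteq> 0"

text \<open>
  Translates of a Borel set are Borel, since translations are homeomorphisms, so the last
  condition never refers to the value that \<open>emeasure\<close> assigns by convention to a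
  non-measurable set.
\<close>

definition transverse :: "'a::complete_metric_linear_space measure \<Rightarrow> 'a set \<Rightarrow> bool"
  where "transverse \<mu> S \<longleftrightarrow>
    nonzero_borel_measure \<mu> \<and> S \<in> sets borel \<and>
    (\<exists>U. compact U \<and> 0 < emeasure \<mu> U \<and> emeasure \<mu> U < 1) \<and>
    (\<forall>v. emeasure \<mu> ((\<lambda>s. s + v) ` S) = 0)"

definition borel_shy :: "'a::complete_metric_linear_space set \<Rightarrow> bool"
  where "borel_shy S \<longleftrightarrow> S \<in> sets borel \<and> (\<exists>\<mu>. transverse \<mu> S)"

definition shy :: "'a::complete_metric_linear_space set \<Rightarrow> bool"
  where "shy A \<longleftrightarrow> (\<exists>S. borel_shy S \<and> A \<subseteq> S)"

text \<open>
  A sequence \<open>(x\<^sub>1, x\<^sub>2, \<dots>)\<close> is represented by a function \<open>x\<close> on \<open>nat\<close>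
  starting at \<open>0\<close>: its \<open>k\<close>-th term, for \<open>k \<ge> 1\<close>, is \<open>x (k - 1)\<close>.
\<close>

definition uniformly_distributed_seqs :: "(nat \<Rightarrow> real) set"
  where "uniformly_distributed_seqs =
    {x. \<forall>c d. - 1 / 2 \<le> c \<and> c < d \<and> d \<le> 1 / 2 \<longrightarrow>
      (\<lambda>n. real (card {k. 1 \<le> k \<and> k \<le> n \<and> x (k - 1) \<in> {c..d}}) / real n)
        \<longlonglongrightarrow> d - c}"

end

theory Submission
  imports Defs
begin

text \<open>
  The transverse measure is Lebesgue measure carried by the line of constant sequences. Adding a
  constant \<open>t > 0\<close> to a sequence that is uniformly distributed in \<open>[-1/2, 1/2]\<close> empties the
  interval \<open>[-1/2, -1/2 + s]\<close>, for \<open>0 < s < min t 1\<close>, up to density zero, whereas uniform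
  distribution of the shifted sequence would give that interval density \<open>s\<close>. Hence
  every line in this direction meets the set at most once, and points are null sets for Lebesgue measure.

  The argument uses only the asymptotic frequencies of the intervals \<open>[-1/2, -1/2 + 1/(m+1)]\<close>
  for \<open>m = 0, 1, 2, \<dots>\<close>. The set of sequences for which these countably many frequencies are
  right is Borel and contains the uniformly distributed sequences, and lines in the direction of
  the constants still meet it at most once (\<open>left_equidistributed_shift_unique\<close>); it is the
  Borel shy set required (\<open>left_equidistributed_borel\<close>,
  \<open>constant_line_measure_translate_eq_0\<close>).
\<close>

definition frequency :: "(nat \<Rightarrow> real) \<Rightarrow> real \<Rightarrow> real \<Rightarrow> nat \<Rightarrow> real"
  where "frequency x c d n = real (card {k. 1 \<le> k \<and> k \<le> n \<and> x (k - 1) \<in> {c..d}}) / real n"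

text \<open>
  Intervals of length \<open>1/(m+1)\<close> anchored at the left endpoint are enough: \<open>m = 0\<close> says that
  almost all terms lie in \<open>[-1/2, 1/2]\<close>, and large \<open>m\<close> detects arbitrarily small shifts.
\<close>

definition left_equidistributed_seqs :: "(nat \<Rightarrow> real) set"
  where "left_equidistributed_seqs =
    {x. \<forall>m. frequency x (- 1 / 2) (- 1 / 2 + 1 / real (Suc m)) \<longlonglongrightarrow> 1 / real (Suc m)}"

lemma uniformly_distributed_subset_left_equidistributed:
  "uniformly_distributed_seqs \<subseteq> left_equidistributed_seqs"
proof
  fix x assume x: "x \<in> uniformly_distributed_seqs"
  have "frequency x (- 1 / 2) (- 1 / 2 + 1 / real (Suc m)) \<longlonglongrightarrow> 1 / real (Suc m)" for m
  proof -
    have "- 1 / 2 < - 1 / 2 + 1 / real (Suc m)" "- 1 / 2 + 1 / real (Suc m) \<le> 1 / 2"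
      by (auto simp: field_simps)
    then have "frequency x (- 1 / 2) (- 1 / 2 + 1 / real (Suc m))
        \<longlonglongrightarrow> - 1 / 2 + 1 / real (Suc m) - - 1 / 2"
      using x unfolding uniformly_distributed_seqs_def frequency_def by blast
    then show ?thesis by simp
  qed
  then show "x \<in> left_equidistributed_seqs"
    by (simp add: left_equidistributed_seqs_def)
qed

lemma measurable_coordinate: "(\<lambda>x. x i) \<in> borel_measurable (borel :: (nat \<Rightarrow> real) measure)"
  by (intro borel_measurable_continuous_onI continuous_on_product_coordinates)

lemma measurable_frequency:
  "(\<lambda>x. frequency x c d n) \<in> borel_measurable (borel :: (nat \<Rightarrow> real) measure)"
proof -
  have "frequency x c d n = (\<Sum>k = 1..n. indicator {c..d} (x (k - 1))) / real n" for x
  proof -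
    have "{k. 1 \<le> k \<and> k \<le> n \<and> x (k - 1) \<in> {c..d}} = {k \<in> {1..n}. x (k - 1) \<in> {c..d}}"
      by auto
    moreover have "real (card {k \<in> {1..n}. x (k - 1) \<in> {c..d}})
        = (\<Sum>k = 1..n. indicator {c..d} (x (k - 1)))"
      by (simp add: indicator_def of_bool_def flip: sum.inter_filter)
    ultimately show ?thesis
      by (simp add: frequency_def)
  qed
  moreover note measurable_coordinate[measurable]
  ultimately show ?thesis
    by simp
qed

text \<open>
  Convergence with all quantifiers ranging over the natural numbers, so that convergence of a
  sequence of measurable functions visibly cuts out a measurable set.
\<close>

lemma tendsto_iff_inverse_Suc:
  fixes X :: "nat \<Rightarrow> 'a::real_normed_vector"
  shows "X \<longlonglongrightarrow> L \<longleftrightarrow> (\<forall>j. \<exists>N. \<forall>n\<ge>N. norm (X n - L) < inverse (real (Suc j)))"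
proof
  assume "X \<longlonglongrightarrow> L"
  then show "\<forall>j. \<exists>N. \<forall>n\<ge>N. norm (X n - L) < inverse (real (Suc j))"
    by (auto simp: LIMSEQ_iff)
next
  assume small: "\<forall>j. \<exists>N. \<forall>n\<ge>N. norm (X n - L) < inverse (real (Suc j))"
  show "X \<longlonglongrightarrow> L"
  proof (rule LIMSEQ_I)
    fix r :: real assume "0 < r"
    then obtain j where "inverse (real (Suc j)) < r"
      using reals_Archimedean by blast
    then show "\<exists>N. \<forall>n\<ge>N. norm (X n - L) < r"
      using small by (meson less_trans)
  qed
qed

lemma left_equidistributed_borel: "left_equidistributed_seqs \<in> sets borel"
proof -
  note measurable_frequency[measurable]
  have "left_equidistributed_seqs = {x \<in> space borel. \<forall>m j. \<exists>N. \<forall>n\<ge>N.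
      norm (frequency x (- 1 / 2) (- 1 / 2 + 1 / real (Suc m)) n - 1 / real (Suc m))
        < inverse (real (Suc j))}"
    by (simp add: left_equidistributed_seqs_def tendsto_iff_inverse_Suc)
  also have "\<dots> \<in> sets borel"
    by measurable
  finally show ?thesis .
qed

text \<open>
  If \<open>c + t > b\<close>, the terms whose shifts by \<open>t\<close> land in \<open>[a, b]\<close> are disjoint from those in
  \<open>[c, d]\<close>, so the two frequencies add up to at most one.
\<close>

lemma frequency_disjoint_shift:
  assumes "b - t < c"
  shows "frequency (\<lambda>k. x k + t) a b n + frequency x c d n \<le> 1"
proof -
  let ?A = "{k. 1 \<le> k \<and> k \<le> n \<and> x (k - 1) + t \<in> {a..b}}"
  let ?B = "{k. 1 \<le> k \<and> k \<le> n \<and> x (k - 1) \<in> {c..d}}"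
  have fin: "finite ?A" "finite ?B"
    by (rule finite_subset[of _ "{1..n}"]; force)+
  have "?A \<inter> ?B = {}"
    using assms by auto
  then have "card ?A + card ?B = card (?A \<union> ?B)"
    using fin by (simp add: card_Un_disjoint)
  also have "\<dots> \<le> card {1..n}"
    by (rule card_mono) auto
  finally have "real (card ?A) + real (card ?B) \<le> real n"
    by (simp flip: of_nat_add)
  then have "(real (card ?A) + real (card ?B)) / real n \<le> 1"
    by (cases "n = 0") (simp_all add: divide_le_eq_1)
  then show ?thesis
    by (simp add: frequency_def add_divide_distrib)
qed

text \<open>
  Almost all terms of \<open>x\<close> lie in \<open>[-1/2, 1/2]\<close>, so almost no term of \<open>x + t\<close> lies below
  \<open>-1/2 + t\<close>; but \<open>[-1/2, -1/2 + 1/(m+1)]\<close> lies below that point once \<open>1/(m+1) < t\<close>.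
\<close>

lemma left_equidistributed_no_positive_shift:
  assumes x: "x \<in> left_equidistributed_seqs" and t: "0 < t"
  shows "(\<lambda>k. x k + t) \<notin> left_equidistributed_seqs"
proof
  assume xt: "(\<lambda>k. x k + t) \<in> left_equidistributed_seqs"
  obtain m where m: "1 / real (Suc m) < t"
    using nat_approx_posE[OF t] by blast
  let ?b = "- 1 / 2 + 1 / real (Suc m)"
  have "frequency (\<lambda>k. x k + t) (- 1 / 2) ?b \<longlonglongrightarrow> 1 / real (Suc m)"
    using xt by (simp add: left_equidistributed_seqs_def)
  moreover have "frequency x (- 1 / 2) (- 1 / 2 + 1 / real (Suc 0)) \<longlonglongrightarrow> 1 / real (Suc 0)"
    using x unfolding left_equidistributed_seqs_def by blast
  ultimately have "(\<lambda>n. frequency (\<lambda>k. x k + t) (- 1 / 2) ?b n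
      + frequency x (- 1 / 2) (- 1 / 2 + 1 / real (Suc 0)) n)
      \<longlonglongrightarrow> 1 / real (Suc m) + 1 / real (Suc 0)"
    by (rule tendsto_add)
  then have "1 / real (Suc m) + 1 / real (Suc 0) \<le> 1"
    by (rule LIMSEQ_le_const2) (use m in \<open>intro exI allI impI frequency_disjoint_shift, simp\<close>)
  then show False
    by simp
qed

lemma left_equidistributed_shift_unique:
  assumes "(\<lambda>k. x k + s) \<in> left_equidistributed_seqs"
    and "(\<lambda>k. x k + t) \<in> left_equidistributed_seqs"
  shows "s = t"
proof -
  have "\<not> s < t" if "(\<lambda>k. x k + s) \<in> left_equidistributed_seqs"
    "(\<lambda>k. x k + t) \<in> left_equidistributed_seqs" for s t
    using left_equidistributed_no_positive_shift[OF that(1), of "t - s"] that(2) by auto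
  then show ?thesis
    using assms by (metis linorder_neqE)
qed

definition constant_line_measure :: "(nat \<Rightarrow> real) measure"
  where "constant_line_measure = distr lborel borel (\<lambda>t _. t)"

lemma continuous_constant_seq: "continuous_on A (\<lambda>t::real. (\<lambda>_::nat. t))"
  by (intro continuous_on_coordinatewise_then_product continuous_on_id)

lemma emeasure_constant_line_measure:
  assumes "A \<in> sets borel"
  shows "emeasure constant_line_measure A = emeasure lborel {t. (\<lambda>_. t) \<in> A}"
proof -
  have "(\<lambda>t _. t) \<in> measurable lborel (borel :: (nat \<Rightarrow> real) measure)"
    using borel_measurable_continuous_onI[OF continuous_constant_seq] by simp
  then show ?thesis
    using assms by (simp add: constant_line_measure_def emeasure_distr vimage_def)
qed

text \<open>
  A translate of a set in which no two points differ by a nonzero constant sequence meets the line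
  of constants at most once.
\<close>

lemma constant_line_measure_translate_eq_0:
  assumes S: "S \<in> sets borel"
    and unique: "\<And>x s t. (\<lambda>k. x k + s) \<in> S \<Longrightarrow> (\<lambda>k. x k + t) \<in> S \<Longrightarrow> s = t"
  shows "emeasure constant_line_measure ((\<lambda>s. s + v) ` S) = 0"
proof -
  have translate: "y \<in> (\<lambda>s. s + v) ` S \<longleftrightarrow> (\<lambda>k. y k - v k) \<in> S" for y
  proof
    assume "(\<lambda>k. y k - v k) \<in> S"
    moreover have "y = (\<lambda>k. y k - v k) + v"
      by (simp add: fun_eq_iff)
    ultimately show "y \<in> (\<lambda>s. s + v) ` S"
      by blast
  qed auto
  have "continuous_on UNIV (\<lambda>(y :: nat \<Rightarrow> real) k. y k - v k)"
    by (intro continuous_on_coordinatewise_then_product continuous_intros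
        continuous_on_product_coordinates)
  then have "(\<lambda>y k. y k - v k) \<in> borel \<rightarrow>\<^sub>M borel"
    by (rule borel_measurable_continuous_onI)
  from measurable_sets[OF this S] have "{y. (\<lambda>k. y k - v k) \<in> S} \<in> sets borel"
    by (simp add: vimage_def)
  moreover have "(\<lambda>s. s + v) ` S = {y. (\<lambda>k. y k - v k) \<in> S}"
    by (simp only: set_eq_iff translate mem_Collect_eq simp_thms)
  ultimately have borel: "(\<lambda>s. s + v) ` S \<in> sets borel"
    by simp
  define T where "T = {t. (\<lambda>k. - v k + t) \<in> S}"
  have "T \<subseteq> {t}" if "t \<in> T" for t
    using that unique[of "\<lambda>k. - v k"] by (auto simp: T_def)
  then have "finite T"
    by (metis all_not_in_conv finite.emptyI finite.insertI finite_subset)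
  then have "emeasure lborel T = 0"
    using finite_imp_null_set_lborel null_setsD1 by blast
  then show ?thesis
    using translate by (simp add: emeasure_constant_line_measure borel T_def)
qed

theorem theorem3p3:
  shows "shy uniformly_distributed_seqs"
proof -
  let ?U = "(\<lambda>t::real. (\<lambda>_::nat. t)) ` {0..1/2}"
  have compact: "compact ?U"
    by (intro compact_continuous_image continuous_constant_seq) simp
  then have "?U \<in> sets borel"
    by (intro borel_closed compact_imp_closed)
  moreover have "{t. (\<lambda>_::nat. t) \<in> ?U} = {0..1/2}"
    by (auto simp: fun_eq_iff)
  ultimately have U: "emeasure constant_line_measure ?U = ennreal (1/2)"
    by (simp add: emeasure_constant_line_measure)
  have "nonzero_borel_measure constant_line_measure"
    unfolding nonzero_borel_measure_def
    by (simp add: emeasure_constant_line_measure) (simp add: constant_line_measure_def)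
  moreover have "\<exists>U. compact U \<and> 0 < emeasure constant_line_measure U
      \<and> emeasure constant_line_measure U < 1"
  proof (intro exI conjI)
    have "ennreal (1/2) < ennreal 1"
      by (subst ennreal_less_iff) auto
    then show "emeasure constant_line_measure ?U < 1"
      unfolding U by simp
    show "0 < emeasure constant_line_measure ?U"
      unfolding U by (subst ennreal_less_zero_iff) simp
  qed (rule compact)
  moreover have "emeasure constant_line_measure ((\<lambda>s. s + v) ` left_equidistributed_seqs) = 0" for v
    by (intro constant_line_measure_translate_eq_0 left_equidistributed_borel)
      (rule left_equidistributed_shift_unique)
  ultimately have "transverse constant_line_measure left_equidistributed_seqs"
    unfolding transverse_def using left_equidistributed_borel by blast
  then have "borel_shy left_equidistributed_seqs"
    unfolding borel_shy_def using left_equidistributed_borel by blast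
  then show ?thesis
    unfolding shy_def using uniformly_distributed_subset_left_equidistributed by blast
qed

end
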